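(* Let $\text{D-Opt}(A,B,s)$ be an arbitrary 0/1 D-Opt instance, with $A\in\mathbb{R}^{n\times m}$ and $B\in\mathbb{R}^{q\times m}$. Let $C:=I_n-A(A^\top A+B^\top B)^{-1}A^\top$, so that $\mathcal{M}(\text{D-Opt}(A,B,s))=\mathrm{MESP}(C,n-s)$. Then $\text{D-Opt}(A,B,s)$ is complementation equivalent to $\mathcal{M}(\text{D-Opt}(A,B,s))+\operatorname{ldet}(A^\top A+B^\top B)$; that is, for every $S\subset N:=\{1,\dots,n\}$ with $|S|=s$, writing $T:=N\setminus S$, $$\operatorname{ldet}\left(A_{S\cdot}^\top A_{S\cdot}+B^\top B\right)=\operatorname{ldet}(C_{T,T})+\operatorname{ldet}(A^\top A+B^\top B).$$
   Context: $\operatorname{ldet}$ is the natural logarithm of the determinant, with value $-\infty$ on singular positive-semidefinite matrices. $C_{T,T}$ is the principal submatrix of $C$ indexed by $T$; $A_{S\cdot}$ is the submatrix of $A$ with rows indexed by $S$. A 0/1 D-Opt instance $\text{D-Opt}(A,B,s)$ is given by $A\in\mathbb{R}^{n\times m}$ with no all-zero rows, $B\in\mathbb{R}^{q\times m}$ ($q\ge1$, zero rows allowed), such that $\begin{pmatrix} A \\ B \end{pmatrix}$ has full column rank $m$, and a nonnegative integer $s$ with $n>s\ge m-\operatorname{rank}(B)$; the problem is to maximize $\operatorname{ldet}(A_{S\cdot}^\top A_{S\cdot}+B^\top B)$ over $S\subset N$ with $|S|=s$. $\mathrm{MESP}(C,t)$ is the problem of maximizing $\operatorname{ldet}(C_{T,T})$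 over $T\subset N$ with $|T|=t$. Adding a constant to a problem means adding it to its objective function. Two problems are complementation equivalent if their feasible 0/1 vectors correspond under $x\mapsto\mathbf{e}-x$ and corresponding solutions have equal objective values (after adding the stated constant). *)

theory Defs
  imports
    "HOL-Library.Extended_Real"
    "Jordan_Normal_Form.Gauss_Jordan_Elimination"
    "Jordan_Normal_Form.DL_Rank"
    "Jordan_Normal_Form.DL_Submatrix"
begin

text \<open>Matrices are indexed from 0, so the ground set \<open>N = {1,...,n}\<close> becomes \<open>{..<n}\<close>.
  The determinant of the \<open>0 \<times> 0\<close> matrix is 1, and \<open>submatrix A {} UNIV\<close> has no rows,
  so its Gram matrix is the zero matrix.\<close>

text \<open>Only meant for positive-semidefinite matrices, where the determinant is nonnegative.\<close>
definition ldet :: "real mat \<Rightarrow> ereal" where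
  "ldet M = (if det M = 0 then -\<infinity> else ereal (ln (det M)))"

text \<open>A 0/1 maximization problem: maximize \<open>objective\<close> over the \<open>feasible\<close> 0/1 vectors of
  dimension \<open>nvars\<close>.\<close>
record zo_problem =
  nvars :: nat
  feasible :: "real vec set"
  objective :: "real vec \<Rightarrow> ereal"

text \<open>A 0/1 vector is identified with the set it is the incidence vector of.\<close>
definition supp :: "real vec \<Rightarrow> nat set" where
  "supp x = {i. i < dim_vec x \<and> x $ i = 1}"

definition subset_vecs :: "nat \<Rightarrow> nat \<Rightarrow> real vec set" where
  "subset_vecs n k = {x \<in> carrier_vec n. (\<forall>i<n. x $ i \<in> {0, 1}) \<and> card (supp x) = k}"

definition info_matrix :: "real mat \<Rightarrow> real mat \<Rightarrow> real mat" where
  "info_matrix A B = A\<^sup>T * A + B\<^sup>T * B"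

definition dopt_instance :: "real mat \<Rightarrow> real mat \<Rightarrow> nat \<Rightarrow> bool" where
  "dopt_instance A B s \<longleftrightarrow>
     (let n = dim_row A; m = dim_col A; q = dim_row B in
        dim_col B = m \<and> 1 \<le> q
        \<and> (\<forall>i<n. row A i \<noteq> 0\<^sub>v m)
        \<and> vec_space.rank (n + q) (A @\<^sub>r B) = m
        \<and> s < n \<and> int m - int (vec_space.rank q B) \<le> int s)"

definition dopt :: "real mat \<Rightarrow> real mat \<Rightarrow> nat \<Rightarrow> zo_problem" where
  "dopt A B s =
     \<lparr>nvars = dim_row A,
      feasible = subset_vecs (dim_row A) s,
      objective = (\<lambda>x. ldet (info_matrix (submatrix A (supp x) UNIV) B))\<rparr>"

definition mesp :: "real mat \<Rightarrow> nat \<Rightarrow> zo_problem" where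
  "mesp C t =
     \<lparr>nvars = dim_row C,
      feasible = subset_vecs (dim_row C) t,
      objective = (\<lambda>x. ldet (submatrix C (supp x) (supp x)))\<rparr>"

text \<open>For a D-Opt instance the information matrix is invertible (by full column rank of the
  stacked matrix), so \<open>mat_inverse\<close> returns its inverse.\<close>
definition mesp_matrix :: "real mat \<Rightarrow> real mat \<Rightarrow> real mat" where
  "mesp_matrix A B =
     1\<^sub>m (dim_row A) - A * the (mat_inverse (info_matrix A B)) * A\<^sup>T"

definition dopt_to_mesp :: "real mat \<Rightarrow> real mat \<Rightarrow> nat \<Rightarrow> zo_problem" where
  "dopt_to_mesp A B s = mesp (mesp_matrix A B) (dim_row A - s)"

definition add_const :: "zo_problem \<Rightarrow> ereal \<Rightarrow> zo_problem" where
  "add_const P c = P\<lparr>objective := (\<lambda>x. objective P x + c)\<rparr>"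

definition compl_vec :: "real vec \<Rightarrow> real vec" where
  "compl_vec x = vec (dim_vec x) (\<lambda>_. 1) - x"

definition complementation_equivalent :: "zo_problem \<Rightarrow> zo_problem \<Rightarrow> bool" where
  "complementation_equivalent P Q \<longleftrightarrow>
     nvars P = nvars Q
     \<and> bij_betw compl_vec (feasible P) (feasible Q)
     \<and> (\<forall>x\<in>feasible P. objective P x = objective Q (compl_vec x))"

end

theory Submission
  imports Defs "Jordan_Normal_Form.DL_Rank_Submatrix"
begin

text \<open>With \<open>M = A\<^sup>T A + B\<^sup>T B\<close> and \<open>X = A\<^bsub>T\<^esub>\<close> the rows of \<open>A\<close> that are left out, the information matrix
  of \<open>S\<close> is \<open>M - X\<^sup>T X = M (I - M\<^sup>-\<^sup>1 X\<^sup>T X)\<close>, while \<open>C\<^bsub>T,T\<^esub> = I - X M\<^sup>-\<^sup>1 X\<^sup>T\<close>. Sylvester's identity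
  \<open>det (I - U V) = det (I - V U)\<close> then gives \<open>det (M - X\<^sup>T X) = det M * det C\<^bsub>T,T\<^esub>\<close>, and full column
  rank makes \<open>det M\<close> nonzero.\<close>

section \<open>Determinant identities for low-rank updates\<close>

text \<open>The block matrix \<open>?G\<close> has two factorizations into block triangular
  matrices. In one the Schur complement \<open>1 - V * U\<close> is the only nontrivial diagonal
  block, in the other it is \<open>1 - U * V\<close>; both products compute
  \<open>det ?G\<close>.\<close>

lemma det_one_minus_mult_commute:
  fixes U V :: "'a :: idom mat"
  assumes U: "U \<in> carrier_mat m k" and V: "V \<in> carrier_mat k m"
  shows "det (1\<^sub>m m - U * V) = det (1\<^sub>m k - V * U)"
proof -
  let ?G = "four_block_mat (1\<^sub>m m) U V (1\<^sub>m k)"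
  have UV: "U * V \<in> carrier_mat m m" and VU: "V * U \<in> carrier_mat k k"
    using U V by auto
  have cancel_VU: "V * U + (1\<^sub>m k - V * U) = 1\<^sub>m k"
    and cancel_UV: "1\<^sub>m m - U * V + U * V = 1\<^sub>m m"
    using U V by (auto intro!: eq_matI)
  have G1: "?G = four_block_mat (1\<^sub>m m) (0\<^sub>m m k) V (1\<^sub>m k)
      * four_block_mat (1\<^sub>m m) U (0\<^sub>m k m) (1\<^sub>m k - V * U)"
    using U V cancel_VU
    by (subst mult_four_block_mat[OF one_carrier_mat zero_carrier_mat V one_carrier_mat
          one_carrier_mat U zero_carrier_mat minus_carrier_mat[OF VU]]) auto
  have G2: "?G = four_block_mat (1\<^sub>m m - U * V) U (0\<^sub>m k m) (1\<^sub>m k)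
      * four_block_mat (1\<^sub>m m) (0\<^sub>m m k) V (1\<^sub>m k)"
    using U V cancel_UV
    by (subst mult_four_block_mat[OF minus_carrier_mat[OF UV] U zero_carrier_mat one_carrier_mat
          one_carrier_mat zero_carrier_mat V one_carrier_mat]) auto
  have "det ?G = det (1\<^sub>m k - V * U)"
    unfolding G1
    using U V VU
    by (subst det_mult[where n = "m + k"])
      (auto simp: det_four_block_mat_upper_right_zero[where n = m and m = k]
         det_four_block_mat_lower_left_zero[where n = m and m = k] minus_carrier_mat)
  moreover have "det ?G = det (1\<^sub>m m - U * V)"
    unfolding G2
    using U V UV
    by (subst det_mult[where n = "m + k"])
      (auto simp: det_four_block_mat_upper_right_zero[where n = m and m = k]
         det_four_block_mat_lower_left_zero[where n = m and m = k] minus_carrier_mat)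
  ultimately show ?thesis by simp
qed

lemma det_minus_gram:
  fixes M N X :: "'a :: idom mat"
  assumes M: "M \<in> carrier_mat m m" and N: "N \<in> carrier_mat m m" and X: "X \<in> carrier_mat k m"
    and MN: "M * N = 1\<^sub>m m"
  shows "det (M - X\<^sup>T * X) = det M * det (1\<^sub>m k - X * N * X\<^sup>T)"
proof -
  \<comment> \<open>Since \<open>M * N\<close> is the identity, this writes the Gram matrix of
    \<open>X\<close> as a multiple of \<open>M\<close>, so that \<open>M\<close> can be factored out
    on the left.\<close>
  have "M * (N * X\<^sup>T * X) = (M * N) * (X\<^sup>T * X)"
    using M N X by (simp add: assoc_mult_mat[of _ m m _ m _ m] assoc_mult_mat[of _ m m _ k _ m])
  then have "M - X\<^sup>T * X = M * (1\<^sub>m m - N * X\<^sup>T * X)"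
    using M N X MN by (subst mult_minus_distrib_mat[of _ m m _ m]) auto
  also have "det \<dots> = det M * det (1\<^sub>m m - N * X\<^sup>T * X)"
    using M N X by (intro det_mult) auto
  \<comment> \<open>Sylvester's identity with \<open>U = N * X\<^sup>T\<close> and
    \<open>V = X\<close>.\<close>
  also have "det (1\<^sub>m m - N * X\<^sup>T * X) = det (1\<^sub>m k - X * (N * X\<^sup>T))"
    using N X by (intro det_one_minus_mult_commute) auto
  also have "X * (N * X\<^sup>T) = X * N * X\<^sup>T"
    using N X by (intro assoc_mult_mat[symmetric]) auto
  finally show ?thesis .
qed

section \<open>Full column rank and invertibility of the information matrix\<close>

text \<open>The rank is the size of a maximal independent subset of \<open>set (cols A)\<close>, so
  this set has at least \<open>nc\<close> elements, as many as the list has entries. Distinctness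
  matters because passing to the set forgets repetitions: independence of the set alone does not
  exclude a repeated column.\<close>

lemma (in vec_space) full_rank_distinct_cols:
  assumes A: "A \<in> carrier_mat n nc" and rank: "rank A = nc"
  shows "distinct (cols A)"
proof -
  obtain S where S: "maximal S (\<lambda>T. T \<subseteq> set (cols A) \<and> lin_indpt T)"
    using maximal_exists[of "(\<lambda>T. T \<subseteq> set (cols A) \<and> lin_indpt T)" "card (set (cols A))" "{}"]
    by (meson List.finite_set card_mono empty_iff empty_subsetI finite_lin_indpt2 rev_finite_subset)
  then have "nc \<le> card (set (cols A))"
    using rank_card_indpt[OF A S] rank by (simp add: card_mono maximal_def)
  then show ?thesis
    using A card_length[of "cols A"] by (intro card_distinct) auto
qed

text \<open>As the columns are distinct, a nonzero kernel vector would be a linear dependence of the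
  set of columns.\<close>

lemma (in vec_space) full_rank_kernel_trivial:
  assumes A: "A \<in> carrier_mat n nc" and rank: "rank A = nc"
    and v: "v \<in> carrier_vec nc" "A *\<^sub>v v = 0\<^sub>v n"
  shows "v = 0\<^sub>v nc"
  using full_rank_distinct_cols[OF A rank] full_rank_lin_indpt[OF A rank] lin_depI[OF A v(1) _ v(2)]
  by blast

lemma real_scalar_prod_self:
  fixes v :: "real vec"
  shows "v \<bullet> v \<ge> 0" and "v \<bullet> v = 0 \<longleftrightarrow> v = 0\<^sub>v (dim_vec v)"
proof -
  show "v \<bullet> v \<ge> 0" by (auto simp: scalar_prod_def intro: sum_nonneg)
  have "v \<bullet> v = 0 \<longleftrightarrow> (\<forall>i<dim_vec v. v $ i = 0)"
    by (auto simp: scalar_prod_def sum_nonneg_eq_0_iff)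
  also have "\<dots> \<longleftrightarrow> v = 0\<^sub>v (dim_vec v)"
    by (simp add: vec_eq_iff)
  finally show "v \<bullet> v = 0 \<longleftrightarrow> v = 0\<^sub>v (dim_vec v)" .
qed

text \<open>If the information matrix kills \<open>v\<close>, its quadratic form at
  \<open>v\<close>, the sum of the squared norms of \<open>A *\<^sub>v v\<close> and
  \<open>B *\<^sub>v v\<close>, is zero. Then both vectors vanish, the stacked matrix kills
  \<open>v\<close>, and full column rank forces \<open>v\<close> to be zero.\<close>

lemma det_info_matrix_nonzero:
  assumes A: "A \<in> carrier_mat n m" and B: "B \<in> carrier_mat q m"
    and rank: "vec_space.rank (n + q) (A @\<^sub>r B) = m"
  shows "det (info_matrix A B) \<noteq> 0"
proof
  assume "det (info_matrix A B) = 0"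
  moreover have "info_matrix A B \<in> carrier_mat m m"
    using A B by (simp add: info_matrix_def)
  ultimately obtain v where v: "v \<in> carrier_vec m" "v \<noteq> 0\<^sub>v m" "info_matrix A B *\<^sub>v v = 0\<^sub>v m"
    using det_0_iff_vec_prod_zero by blast
  have "(A\<^sup>T * A + B\<^sup>T * B) *\<^sub>v v = A\<^sup>T *\<^sub>v (A *\<^sub>v v) + B\<^sup>T *\<^sub>v (B *\<^sub>v v)"
    using A B v(1) by (simp add: add_mult_distrib_mat_vec[of _ m m]
      assoc_mult_mat_vec[of "A\<^sup>T" m n A m] assoc_mult_mat_vec[of "B\<^sup>T" m q B m])
  then have "0 = (A\<^sup>T *\<^sub>v (A *\<^sub>v v) + B\<^sup>T *\<^sub>v (B *\<^sub>v v)) \<bullet> v"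
    using v by (simp add: info_matrix_def)
  also have "\<dots> = (A *\<^sub>v v) \<bullet> (A *\<^sub>v v) + (B *\<^sub>v v) \<bullet> (B *\<^sub>v v)"
    using A B v(1) by (simp add: add_scalar_prod_distrib[of _ m]
      transpose_vec_mult_scalar[of A n m] transpose_vec_mult_scalar[of B q m])
  finally have "A *\<^sub>v v = 0\<^sub>v n" "B *\<^sub>v v = 0\<^sub>v q"
    using real_scalar_prod_self[of "A *\<^sub>v v"] real_scalar_prod_self[of "B *\<^sub>v v"] A B by auto
  then have "(A @\<^sub>r B) *\<^sub>v v = 0\<^sub>v (n + q)"
    using mat_mult_append[OF A B v(1)] by auto
  then have "v = 0\<^sub>v m"
    using vec_space.full_rank_kernel_trivial[OF carrier_append_rows[OF A B] rank v(1)] by blast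
  with v(2) show False by contradiction
qed

lemma mat_inverse_nonzero_det:
  fixes M :: "'a :: field mat"
  assumes M: "M \<in> carrier_mat m m" and det: "det M \<noteq> 0"
  shows "the (mat_inverse M) \<in> carrier_mat m m" and "M * the (mat_inverse M) = 1\<^sub>m m"
proof -
  have "mat_inverse M \<noteq> None"
    \<comment> \<open>\<open>undefined\<close> fills a free parameter of the matrix ring, so that
      both facts speak of units of the same ring.\<close>
    using mat_inverse(1)[OF M, of undefined] det_non_zero_imp_unit[OF M det, of undefined] by blast
  then obtain N where "mat_inverse M = Some N" by blast
  then show "the (mat_inverse M) \<in> carrier_mat m m" and "M * the (mat_inverse M) = 1\<^sub>m m"
    using mat_inverse(2)[OF M] by auto
qed

section \<open>Submatrices and Gram matrices of selected rows\<close>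

text \<open>\<open>pick S\<close> enumerates \<open>S\<close> increasingly: strict monotonicity
  gives injectivity, and counting gives surjectivity. This turns sums over the rows of a submatrix
  into sums over \<open>S\<close>.\<close>

lemma bij_betw_pick:
  assumes "finite S"
  shows "bij_betw (pick S) {..<card S} S"
proof -
  have inj: "inj_on (pick S) {..<card S}"
    using pick_mono_le[of _ S] by (auto intro!: linorder_inj_onI) (metis less_irrefl)
  moreover have "pick S ` {..<card S} \<subseteq> S"
    using pick_in_set_le by auto
  then have "pick S ` {..<card S} = S"
    using inj assms by (intro card_subset_eq) (auto simp: card_image)
  ultimately show ?thesis by (simp add: bij_betw_def)
qed

text \<open>The set on the left is the form in which the dimensions of a submatrix arise.\<close>

lemma card_rows_subset: "I \<subseteq> {..<n} \<Longrightarrow> card {i. i < n \<and> i \<in> I} = card I"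
  by (rule arg_cong[of _ _ card]) auto

lemma submatrix_rows_carrier:
  assumes "A \<in> carrier_mat n m" "I \<subseteq> {..<n}"
  shows "submatrix A I UNIV \<in> carrier_mat (card I) m"
  using assms by (intro carrier_matI) (simp_all add: dim_submatrix card_rows_subset)

lemma gram_rows_index:
  fixes A :: "'a :: comm_semiring_0 mat"
  assumes A: "A \<in> carrier_mat n m" and I: "I \<subseteq> {..<n}" and ij: "i < m" "j < m"
  shows "((submatrix A I UNIV)\<^sup>T * submatrix A I UNIV) $$ (i, j) = (\<Sum>k\<in>I. A $$ (k, i) * A $$ (k, j))"
proof -
  let ?X = "submatrix A I UNIV"
  have X: "?X \<in> carrier_mat (card I) m" using submatrix_rows_carrier[OF A I] .
  have "(?X\<^sup>T * ?X) $$ (i, j) = (\<Sum>k<card I. ?X $$ (k, i) * ?X $$ (k, j))"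
    using X ij by (auto simp: scalar_prod_def atLeast0LessThan)
  also have "\<dots> = (\<Sum>k<card I. A $$ (pick I k, i) * A $$ (pick I k, j))"
    using A I ij by (intro sum.cong) (auto simp: submatrix_index card_rows_subset pick_UNIV)
  also have "\<dots> = (\<Sum>k\<in>I. A $$ (k, i) * A $$ (k, j))"
    using I by (intro sum.reindex_bij_betw bij_betw_pick) (auto intro: finite_subset)
  finally show ?thesis .
qed

text \<open>Each entry of a Gram matrix is a sum over row indices, and the sum over all rows splits
  into the parts over \<open>S\<close> and over its complement.\<close>

lemma gram_rows_compl:
  fixes A :: "'a :: comm_ring mat"
  assumes A: "A \<in> carrier_mat n m" and S: "S \<subseteq> {..<n}"
  shows "(submatrix A S UNIV)\<^sup>T * submatrix A S UNIV
    = A\<^sup>T * A - (submatrix A ({..<n} - S) UNIV)\<^sup>T * submatrix A ({..<n} - S) UNIV"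
    (is "?GS = _ - ?GT")
proof (rule eq_matI)
  have carr: "?GS \<in> carrier_mat m m" "?GT \<in> carrier_mat m m"
    using submatrix_rows_carrier[OF A, of S] submatrix_rows_carrier[OF A, of "{..<n} - S"] S by auto
  from carrier_matD[OF carr(1)] carrier_matD[OF carr(2)]
  show "dim_row ?GS = dim_row (A\<^sup>T * A - ?GT)" "dim_col ?GS = dim_col (A\<^sup>T * A - ?GT)"
    by (simp_all only: index_minus_mat)
  fix i j assume "i < dim_row (A\<^sup>T * A - ?GT)" "j < dim_col (A\<^sup>T * A - ?GT)"
  then have ij: "i < m" "j < m" using carr by auto
  let ?f = "\<lambda>k. A $$ (k, i) * A $$ (k, j)"
  have "(A\<^sup>T * A) $$ (i, j) = sum ?f {..<n}"
    using A ij by (auto simp: scalar_prod_def atLeast0LessThan)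
  also have "\<dots> = sum ?f ({..<n} - S) + sum ?f S"
    using S by (intro sum.subset_diff) auto
  finally show "?GS $$ (i, j) = (A\<^sup>T * A - ?GT) $$ (i, j)"
    using carr ij gram_rows_index[OF A S ij] gram_rows_index[OF A, of "{..<n} - S", OF _ ij]
    by auto
qed

text \<open>An entry of \<open>A * N * A\<^sup>T\<close> involves only the two rows of
  \<open>A\<close> with its indices, so restricting both indices to \<open>T\<close> amounts to
  restricting the rows of \<open>A\<close>.\<close>

lemma submatrix_one_minus_congruence:
  fixes A N :: "'a :: comm_ring_1 mat"
  assumes A: "A \<in> carrier_mat n m" and N: "N \<in> carrier_mat m m" and T: "T \<subseteq> {..<n}"
  shows "submatrix (1\<^sub>m n - A * N * A\<^sup>T) T T
    = 1\<^sub>m (card T) - submatrix A T UNIV * N * (submatrix A T UNIV)\<^sup>T"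
    (is "submatrix ?C T T = 1\<^sub>m _ - ?X * N * ?X\<^sup>T")
proof (rule eq_matI)
  have X: "?X \<in> carrier_mat (card T) m" using submatrix_rows_carrier[OF A T] .
  have C: "?C \<in> carrier_mat n n" using A N by auto
  show "dim_row (submatrix ?C T T) = dim_row (1\<^sub>m (card T) - ?X * N * ?X\<^sup>T)"
    "dim_col (submatrix ?C T T) = dim_col (1\<^sub>m (card T) - ?X * N * ?X\<^sup>T)"
    using A X T by (auto simp: dim_submatrix card_rows_subset)
  fix i j assume "i < dim_row (1\<^sub>m (card T) - ?X * N * ?X\<^sup>T)" "j < dim_col (1\<^sub>m (card T) - ?X * N * ?X\<^sup>T)"
  then have ij: "i < card T" "j < card T" using X by auto
  have row: "row ?X k = row A (pick T k)" if "k < card T" for k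
    using that A T by (intro row_submatrix_UNIV) (auto simp: card_rows_subset)
  have "pick T i \<in> T" "pick T j \<in> T" using ij by (auto intro: pick_in_set_le)
  then have p: "pick T i < n" "pick T j < n" using T by auto
  \<comment> \<open>Injectivity of \<open>pick T\<close> is what makes the identity matrix restrict
    to the identity matrix.\<close>
  have eq: "pick T i = pick T j \<longleftrightarrow> i = j"
    using ij bij_betw_pick[of T] T
    by (auto simp: bij_betw_def inj_on_def dest: finite_subset)
  have rowN: "row (?X * N) i = row (A * N) (pick T i)"
    using A N X p ij row by (auto intro!: eq_vecI)
  have "submatrix ?C T T $$ (i, j) = ?C $$ (pick T i, pick T j)"
    using ij C T by (intro submatrix_index) (auto simp: card_rows_subset)
  also have "\<dots> = (1\<^sub>m (card T) - ?X * N * ?X\<^sup>T) $$ (i, j)"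
    using A N X p ij by (auto simp: eq row rowN)
  finally show "submatrix ?C T T $$ (i, j) = (1\<^sub>m (card T) - ?X * N * ?X\<^sup>T) $$ (i, j)" .
qed

section \<open>The log-determinant identity\<close>

text \<open>Isabelle's real logarithm satisfies \<open>ln (- x) = ln x\<close>, so it is additive on all nonzero reals.\<close>
lemma ldet_eq_add:
  assumes "det P = det M * det Q" and "det M \<noteq> 0"
  shows "ldet P = ldet Q + ldet M"
  using assms by (auto simp: ldet_def ln_mult)

lemma ldet_info_matrix_rows:
  assumes A: "A \<in> carrier_mat n m" and B: "B \<in> carrier_mat q m"
    and det: "det (info_matrix A B) \<noteq> 0" and S: "S \<subseteq> {..<n}"
  shows "ldet (info_matrix (submatrix A S UNIV) B)
    = ldet (submatrix (mesp_matrix A B) ({..<n} - S) ({..<n} - S)) + ldet (info_matrix A B)"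
proof -
  let ?T = "{..<n} - S" and ?M = "info_matrix A B"
  let ?X = "submatrix A ?T UNIV" and ?N = "the (mat_inverse ?M)"
  have M: "?M \<in> carrier_mat m m" using A B by (simp add: info_matrix_def)
  note N = mat_inverse_nonzero_det[OF M det]
  have X: "?X \<in> carrier_mat (card ?T) m" by (rule submatrix_rows_carrier[OF A]) blast
  have "info_matrix (submatrix A S UNIV) B = ?M - ?X\<^sup>T * ?X"
  proof -
    \<comment> \<open>Replacing the Gram matrix of \<open>S\<close> leaves the subtracted term
      between the two summands of the information matrix; this moves it to the end.\<close>
    have "P - Q + R = P + R - Q"
      if "P \<in> carrier_mat m m" "Q \<in> carrier_mat m m" "R \<in> carrier_mat m m" for P Q R :: "real mat"
      using that by (intro eq_matI) auto
    moreover have "A\<^sup>T * A \<in> carrier_mat m m" "?X\<^sup>T * ?X \<in> carrier_mat m m" "B\<^sup>T * B \<in> carrier_mat m m"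
      using A B X by simp_all
    ultimately show ?thesis
      unfolding info_matrix_def gram_rows_compl[OF A S] by (simp only:)
  qed
  moreover have "submatrix (mesp_matrix A B) ?T ?T = 1\<^sub>m (card ?T) - ?X * ?N * ?X\<^sup>T"
    unfolding mesp_matrix_def carrier_matD(1)[OF A]
    by (rule submatrix_one_minus_congruence[OF A N(1)]) blast
  ultimately have "det (info_matrix (submatrix A S UNIV) B) = det ?M * det (submatrix (mesp_matrix A B) ?T ?T)"
    using det_minus_gram[OF M N(1) X N(2)] by (simp only:)
  then show ?thesis using det by (rule ldet_eq_add)
qed

section \<open>Complementation of 0/1 vectors and the equivalence\<close>

lemma compl_vec_involution: "compl_vec (compl_vec x) = x"
  by (rule eq_vecI) (auto simp: compl_vec_def)

lemma supp_subset: "x \<in> subset_vecs n k \<Longrightarrow> supp x \<subseteq> {..<n}"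
  by (auto simp: supp_def subset_vecs_def)

lemma supp_compl_vec:
  assumes "x \<in> subset_vecs n k"
  shows "supp (compl_vec x) = {..<n} - supp x"
  using assms by (fastforce simp: supp_def subset_vecs_def compl_vec_def)

lemma compl_vec_subset_vecs:
  assumes x: "x \<in> subset_vecs n k"
  shows "compl_vec x \<in> subset_vecs n (n - k)"
proof -
  have "card (supp (compl_vec x)) = n - k"
    using x supp_subset[OF x] by (simp add: supp_compl_vec[OF x] card_Diff_subset finite_subset subset_vecs_def)
  then show ?thesis
    using x by (auto simp: subset_vecs_def compl_vec_def)
qed

lemma bij_betw_compl_vec:
  assumes "k \<le> n"
  shows "bij_betw compl_vec (subset_vecs n k) (subset_vecs n (n - k))"
proof (rule bij_betw_byWitness[where f' = compl_vec])
  show "compl_vec ` subset_vecs n k \<subseteq> subset_vecs n (n - k)"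
    using compl_vec_subset_vecs by blast
  \<comment> \<open>Here \<open>k \<le> n\<close> enters: with truncated subtraction it gives
    \<open>n - (n - k) = k\<close>.\<close>
  show "compl_vec ` subset_vecs n (n - k) \<subseteq> subset_vecs n k"
    using compl_vec_subset_vecs[of _ n "n - k"] assms by (simp add: image_subset_iff)
qed (simp_all add: compl_vec_involution)

theorem theorem11:
  fixes A B C :: "real mat" and n m q s :: nat
  assumes A: "A \<in> carrier_mat n m"
    and B: "B \<in> carrier_mat q m"
    and inst: "dopt_instance A B s"
    and C: "C = 1\<^sub>m n - A * the (mat_inverse (A\<^sup>T * A + B\<^sup>T * B)) * A\<^sup>T"
  shows "dopt_to_mesp A B s = mesp C (n - s)
    \<and> complementation_equivalent (dopt A B s)
          (add_const (dopt_to_mesp A B s) (ldet (A\<^sup>T * A + B\<^sup>T * B)))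
    \<and> (\<forall>S T. S \<subseteq> {..<n} \<and> card S = s \<and> T = {..<n} - S \<longrightarrow>
          ldet ((submatrix A S UNIV)\<^sup>T * submatrix A S UNIV + B\<^sup>T * B)
            = ldet (submatrix C T T) + ldet (A\<^sup>T * A + B\<^sup>T * B))"
proof -
  have C': "C = mesp_matrix A B"
    using A by (simp add: C mesp_matrix_def info_matrix_def)
  have mesp: "dopt_to_mesp A B s = mesp C (n - s)"
    using A by (simp add: dopt_to_mesp_def C')
  have s: "s \<le> n" and rank: "vec_space.rank (n + q) (A @\<^sub>r B) = m"
    using inst A B by (auto simp: dopt_instance_def Let_def)
  \<comment> \<open>This set identity serves both claims. At \<open>S = supp x\<close> it equates
    the objective values of \<open>x\<close> and \<open>compl_vec x\<close>, whose support is the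
    complement of \<open>S\<close>; read directly it is the last conjunct.\<close>
  note key = ldet_info_matrix_rows[OF A B det_info_matrix_nonzero[OF A B rank], folded C']
  have dims: "dim_row A = n" "dim_row C = n"
    using A by (auto simp: C)
  have "complementation_equivalent (dopt A B s) (add_const (mesp C (n - s)) (ldet (info_matrix A B)))"
    using bij_betw_compl_vec[OF s] key[OF supp_subset]
    by (simp add: complementation_equivalent_def dopt_def mesp_def add_const_def dims supp_compl_vec)
  then show ?thesis
    using key mesp by (simp add: info_matrix_def)
qed

end
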